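(* Let $n\in\mathbb{N}$ and let $\upsilon$ be an even positive integer with $\upsilon\le 2n$. Let $\omega_\upsilon(x)=(1+x^2)^{-\upsilon/2}$. Then, for every nonnegative integer $m\le\upsilon-2$, $$\int_{\mathbb{R}}x^m\,\omega_\upsilon(x)\,dx=Q_{\omega_\upsilon,n}(x^m),$$ where $Q_{\omega_\upsilon,n}$ is the Möbius-transformed trapezoidal rule for the weight $\omega_\upsilon$ with parameter $\gamma=1$.
   Context: With $\gamma=1$, the change of variables is $\phi(\theta)=-\cot(\theta/2)$, $\theta\in(0,2\pi)$, so $\phi'(\theta)=1/(2\sin^2(\theta/2))$. The Möbius-transformed trapezoidal rule for the weight $\omega_\upsilon$ is $$Q_{\omega_\upsilon,n}(f)=\frac{2\pi}{n}\sum_{j=1}^n f(\phi(\theta_j))\,\omega_\upsilon(\phi(\theta_j))\,\phi'(\theta_j),\qquad \theta_j=\frac{2\pi j}{n}-\frac{\pi}{n},\ j=1,\dots,n,$$ and $Q_{\omega_\upsilon,n}(x^m)$ means the rule applied to the function $f(x)=x^m$. *)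

theory Defs
  imports "HOL-Analysis.Analysis"
begin

definition weight :: "nat \<Rightarrow> real \<Rightarrow> real" where
  "weight \<upsilon> x = (1 + x\<^sup>2) powr (- real \<upsilon> / 2)"

text \<open>The change of variables from \<open>(0, 2 * pi)\<close> onto the real line, with parameter \<open>\<gamma> = 1\<close>.
  Outside \<open>(0, 2 * pi)\<close> its values carry no meaning.\<close>

definition moebius_phi :: "real \<Rightarrow> real" where
  "moebius_phi \<theta> = - cot (\<theta> / 2)"

definition trap_node :: "nat \<Rightarrow> nat \<Rightarrow> real" where
  "trap_node n j = 2 * pi * real j / real n - pi / real n"

definition moebius_trapezoid :: "(real \<Rightarrow> real) \<Rightarrow> nat \<Rightarrow> (real \<Rightarrow> real) \<Rightarrow> real" where
  "moebius_trapezoid \<omega> n f = 2 * pi / real n *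
     (\<Sum>j = 1..n. f (moebius_phi (trap_node n j)) * \<omega> (moebius_phi (trap_node n j))
        * deriv moebius_phi (trap_node n j))"

lemma trap_node_bounds:
  assumes "j \<in> {1..n}"
  shows "0 < trap_node n j" "trap_node n j < 2 * pi"
proof -
  have n: "real n > 0" and j1: "real j \<ge> 1" and jn: "real j \<le> real n" using assms by auto
  have eq: "trap_node n j = pi * ((2 * real j - 1) / real n)"
    by (simp add: trap_node_def diff_divide_distrib right_diff_distrib)
  show "0 < trap_node n j" unfolding eq using n j1 by simp
  have "(2 * real j - 1) / real n < 2" using n jn by (simp add: divide_less_eq)
  then have "pi * ((2 * real j - 1) / real n) < pi * 2" by (intro mult_strict_left_mono) auto
  then show "trap_node n j < 2 * pi" unfolding eq by (simp add: mult.commute)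
qed

lemma deriv_moebius_phi:
  assumes "0 < \<theta>" "\<theta> < 2 * pi"
  shows "deriv moebius_phi \<theta> = 1 / (2 * (sin (\<theta> / 2))\<^sup>2)"
proof -
  have "sin (\<theta> / 2) \<noteq> 0" using sin_gt_zero[of "\<theta> / 2"] assms by simp
  then have "((\<lambda>t. - cot (t / 2)) has_real_derivative 1 / (2 * (sin (\<theta> / 2))\<^sup>2)) (at \<theta>)"
    by (auto intro!: derivative_eq_intros DERIV_chain2[OF DERIV_cot] simp: field_simps)
  then show ?thesis
    unfolding moebius_phi_def[abs_def] by (rule DERIV_imp_deriv)
qed

end

theory Submission
  imports Defs "HOL-Computational_Algebra.Polynomial"
begin

text \<open>Write \<open>\<upsilon> = 2 * (d + 1)\<close>. Under \<open>x = - cot (t / 2)\<close> we have \<open>1 + x\<^sup>2 = 1 / (sin (t / 2))\<^sup>2\<close>, so the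
  transformed integrand is a constant multiple of \<open>cos (t / 2) ^ m * sin (t / 2) ^ (2 * d - m)\<close>. The total
  exponent \<open>2 * d\<close> is even, so this is a trigonometric polynomial in \<open>t\<close> of degree at most \<open>d < n\<close>, and
  the \<open>n\<close>-point trapezoidal rule integrates such polynomials exactly over a period: for \<open>0 < \<bar>l\<bar> < n\<close> the
  values of \<open>cis (l * t)\<close> at the nodes form a geometric progression whose ratio is a nontrivial
  \<open>n\<close>-th root of unity, hence sum to zero.\<close>

lemma sum_cis_trap_node:
  fixes l :: int
  assumes "\<bar>l\<bar> < int n"
  shows "(\<Sum>j = 1..n. cis (of_int l * trap_node n j)) = (if l = 0 then of_nat n else 0)"
proof (cases "l = 0")
  case False
  have n: "n > 0" using assms by auto
  define r where "r = cis (of_int l * (2 * pi / n))"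
  have "r \<noteq> 1"
  proof
    assume "r = 1"
    then have "cos (of_int l * (2 * pi / n)) = 1"
      unfolding r_def by (metis cis.sel(1) one_complex.sel(1))
    then obtain k :: int where "of_int l * (2 * pi / n) = of_int k * 2 * pi"
      unfolding cos_one_2pi_int by blast
    \<comment> \<open>A trivial ratio would make \<open>l\<close> a multiple of \<open>n\<close>,
      impossible for \<open>0 < \<bar>l\<bar> < n\<close>.\<close>
    then have "real_of_int l = of_int (k * int n)"
      using n by (simp add: field_simps)
    then have "l = k * int n" by (simp only: of_int_eq_iff)
    then have "int n dvd l" by simp
    then show False using assms False dvd_imp_le_int[of l "int n"] by auto
  qed
  have "r ^ n = 1"
    unfolding r_def Complex.DeMoivre using n cis_multiple_2pi[of "of_int l"]
    by (simp add: mult_ac)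
  \<comment> \<open>The half-step shift of the nodes contributes only a factor independent of
    \<open>j\<close>.\<close>
  have "cis (of_int l * trap_node n j) = cis (- of_int l * pi / n) * r ^ j" for j
    unfolding r_def Complex.DeMoivre cis_mult trap_node_def
    by (simp add: algebra_simps)
  then have "(\<Sum>j = 1..n. cis (of_int l * trap_node n j))
      = cis (- of_int l * pi / n) * (\<Sum>j = 1..n. r ^ j)"
    by (simp only: sum_distrib_left)
  also have "(\<Sum>j = 1..n. r ^ j) = 0"
    using \<open>r \<noteq> 1\<close> \<open>r ^ n = 1\<close> n by (simp add: sum_gp)
  finally show ?thesis using False by simp
qed simp

lemma has_integral_cis_period:
  fixes l :: int
  shows "((\<lambda>t. cis (of_int l * t)) has_integral (if l = 0 then 2 * pi else 0)) {0..2 * pi}"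
proof (cases "l = 0")
  case True
  then show ?thesis
    using has_integral_const_real[of "1::complex" 0 "2 * pi"] by (simp add: scaleR_conv_of_real)
next
  case False
  have "((\<lambda>t. cis (of_int l * t)) has_integral
      cis (of_int l * (2 * pi)) / (\<i> * of_int l) - cis (of_int l * 0) / (\<i> * of_int l)) {0..2 * pi}"
  proof (rule fundamental_theorem_of_calculus)
    fix t :: real
    show "((\<lambda>t. cis (of_int l * t) / (\<i> * of_int l)) has_vector_derivative cis (of_int l * t))
        (at t within {0..2 * pi})"
    proof -
      \<comment> \<open>The antiderivative is differentiated as a complex function and then
        restricted to the real axis.\<close>
      have "((\<lambda>z. exp (\<i> * of_int l * z) / (\<i> * of_int l)) has_field_derivative
          exp (\<i> * of_int l * of_real t)) (at (of_real t))"
        using False by (auto intro!: derivative_eq_intros)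
      from has_vector_derivative_real_field[OF this] show ?thesis
        by (simp add: cis_conv_exp mult_ac)
    qed
  qed simp
  then show ?thesis
    using False cis_multiple_2pi[of "of_int l"] by (simp add: mult_ac)
qed

text \<open>The coefficients come from \<open>cos s = cis (- s) * (cis (2 * s) + 1) / 2\<close> and
  \<open>sin s = cis (- s) * (cis (2 * s) - 1) / (2 * \<i>)\<close> at \<open>s = t / 2\<close>.\<close>

lemma cos_pow_sin_pow_fourier:
  assumes "a + b = 2 * d"
  obtains c :: "nat \<Rightarrow> complex" where
    "\<And>t. complex_of_real (cos (t / 2) ^ a * sin (t / 2) ^ b)
       = (\<Sum>i\<le>2 * d. c i * cis (of_int (int i - int d) * t))"
proof -
  define p :: "complex poly" where
    "p = [:1 / 2, 1 / 2:] ^ a * [:- 1 / (2 * \<i>), 1 / (2 * \<i>):] ^ b"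
  have deg: "degree p \<le> 2 * d"
  proof -
    have "degree p \<le> degree ([:1 / 2, 1 / 2 :: complex:] ^ a)
        + degree ([:- 1 / (2 * \<i>), 1 / (2 * \<i>):] ^ b)"
      unfolding p_def by (rule degree_mult_le)
    also have "\<dots> = 2 * d" using assms by (simp add: degree_power_eq)
    finally show ?thesis .
  qed
  have "complex_of_real (cos (t / 2) ^ a * sin (t / 2) ^ b)
       = (\<Sum>i\<le>2 * d. coeff p i * cis (of_int (int i - int d) * t))" for t
  proof -
    have cis_t: "cis t = cis (t / 2) * cis (t / 2)" by (simp add: cis_mult)
    have inv: "cis (- (t / 2)) * cis (t / 2) = 1" by (simp add: cis_mult)
    have c: "complex_of_real (cos (t / 2)) = cis (- (t / 2)) * poly [:1 / 2, 1 / 2:] (cis t)"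
    proof -
      have "cis (- (t / 2)) * poly [:1 / 2, 1 / 2:] (cis t)
          = (cis (- (t / 2)) + cis (- (t / 2)) * cis (t / 2) * cis (t / 2)) / 2"
        by (simp add: cis_t field_simps)
      also have "\<dots> = complex_of_real (cos (t / 2))"
        unfolding inv by (simp add: complex_eq_iff)
      finally show ?thesis by simp
    qed
    have s: "complex_of_real (sin (t / 2))
        = cis (- (t / 2)) * poly [:- 1 / (2 * \<i>), 1 / (2 * \<i>):] (cis t)"
    proof -
      have "cis (- (t / 2)) * poly [:- 1 / (2 * \<i>), 1 / (2 * \<i>):] (cis t)
          = (cis (- (t / 2)) * cis (t / 2) * cis (t / 2) - cis (- (t / 2))) / (2 * \<i>)"
        by (simp add: cis_t field_simps)
      also have "\<dots> = complex_of_real (sin (t / 2))"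
        unfolding inv by (simp add: complex_eq_iff)
      finally show ?thesis by simp
    qed
    have "complex_of_real (cos (t / 2) ^ a * sin (t / 2) ^ b)
        = cis (- (t / 2)) ^ (a + b) * poly p (cis t)"
      unfolding of_real_mult of_real_power c s p_def
      by (simp only: poly_mult poly_power power_mult_distrib power_add mult_ac)
    \<comment> \<open>Since \<open>a + b\<close> is even, the half-angle factors combine into the
      integer frequency \<open>- d\<close>, which shifts the exponents \<open>0..2 * d\<close> of
      \<open>p\<close> to \<open>- d..d\<close>.\<close>
    also have "cis (- (t / 2)) ^ (a + b) = cis (- (real d * t))"
      unfolding assms Complex.DeMoivre by simp
    also have "poly p (cis t) = (\<Sum>i\<le>2 * d. coeff p i * cis t ^ i)"
      unfolding poly_altdef using deg
      by (intro sum.mono_neutral_left) (auto simp: coeff_eq_0)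
    also have "cis (- (real d * t)) * \<dots>
        = (\<Sum>i\<le>2 * d. coeff p i * cis (of_int (int i - int d) * t))"
      unfolding sum_distrib_left Complex.DeMoivre
      by (intro sum.cong) (auto simp: mult.left_commute cis_mult algebra_simps)
    finally show ?thesis .
  qed
  then show thesis by (rule that)
qed

text \<open>By linearity it suffices to compare rule and integral on each Fourier mode. All
  frequencies are at most \<open>d < n\<close> in absolute value, so both give \<open>2 * pi\<close>
  at frequency 0 and 0 elsewhere.\<close>

lemma trapezoid_exact_cos_pow_sin_pow:
  assumes "a + b = 2 * d" "d < n"
  shows "((\<lambda>t. cos (t / 2) ^ a * sin (t / 2) ^ b) has_integral
     2 * pi / n * (\<Sum>j = 1..n. cos (trap_node n j / 2) ^ a * sin (trap_node n j / 2) ^ b))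
     {0..2 * pi}"
proof -
  let ?h = "\<lambda>t::real. cos (t / 2) ^ a * sin (t / 2) ^ b"
  obtain c :: "nat \<Rightarrow> complex" where
    c: "\<And>t. complex_of_real (?h t) = (\<Sum>i\<le>2 * d. c i * cis (of_int (int i - int d) * t))"
    using cos_pow_sin_pow_fourier[OF assms(1)] by blast
  have "((\<lambda>t. complex_of_real (?h t)) has_integral
      (\<Sum>i\<le>2 * d. c i * (if int i - int d = 0 then 2 * pi else 0))) {0..2 * pi}"
    unfolding c
    by (intro has_integral_sum has_integral_mult_right has_integral_cis_period finite_atMost)
  also have "(\<Sum>i\<le>2 * d. c i * (if int i - int d = 0 then 2 * pi else 0))
      = (\<Sum>i\<le>2 * d. complex_of_real (2 * pi / n)
           * (c i * (\<Sum>j = 1..n. cis (of_int (int i - int d) * trap_node n j))))"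
  proof (intro sum.cong refl)
    fix i assume "i \<in> {..2 * d}"
    then have "\<bar>int i - int d\<bar> < int n" using assms(2) by auto
    from sum_cis_trap_node[OF this]
    show "c i * (if int i - int d = 0 then 2 * pi else 0) = complex_of_real (2 * pi / n)
           * (c i * (\<Sum>j = 1..n. cis (of_int (int i - int d) * trap_node n j)))"
      using assms(2) by simp
  qed
  also have "\<dots> = complex_of_real (2 * pi / n) * (\<Sum>j = 1..n. complex_of_real (?h (trap_node n j)))"
    unfolding c sum_distrib_left by (rule sum.swap)
  finally have "((\<lambda>t. complex_of_real (?h t)) has_integral
      complex_of_real (2 * pi / n * (\<Sum>j = 1..n. ?h (trap_node n j)))) {0..2 * pi}"
    by simp
  from has_integral_Re[OF this] show ?thesis by (simp only: Re_complex_of_real)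
qed

text \<open>The shift carries \<open>(0, 2 * pi)\<close> onto the principal branch of
  \<open>tan\<close>, so \<open>arctan\<close> supplies the inverse. At the poles both sides are 0,
  by division by zero.\<close>

lemma moebius_phi_eq_tan: "moebius_phi t = tan (t / 2 - pi / 2)"
  unfolding moebius_phi_def cot_def tan_def by (simp add: sin_diff cos_diff)

lemma moebius_phi_arctan: "moebius_phi (2 * arctan x + pi) = x"
proof -
  have "(2 * arctan x + pi) / 2 - pi / 2 = arctan x" by (simp add: field_simps)
  then show ?thesis by (simp only: moebius_phi_eq_tan tan_arctan)
qed

lemma arctan_moebius_phi:
  assumes "0 < t" "t < 2 * pi"
  shows "2 * arctan (moebius_phi t) + pi = t"
  using assms arctan_tan[of "t / 2 - pi / 2"] by (simp add: moebius_phi_eq_tan)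

lemma inj_on_moebius_phi: "inj_on moebius_phi {0<..<2 * pi}"
  by (rule inj_on_inverseI[where g = "\<lambda>x. 2 * arctan x + pi"]) (simp add: arctan_moebius_phi)

lemma moebius_phi_image: "moebius_phi ` {0<..<2 * pi} = UNIV"
proof -
  have "2 * arctan x + pi \<in> {0<..<2 * pi}" for x
    using arctan_lbound[of x] arctan_ubound[of x] by simp
  then show ?thesis by (metis UNIV_eq_I image_eqI moebius_phi_arctan)
qed

lemma has_derivative_moebius_phi:
  assumes "0 < t" "t < 2 * pi"
  shows "(moebius_phi has_real_derivative 1 / (2 * (sin (t / 2))\<^sup>2)) (at t)"
proof -
  have "sin (t / 2) \<noteq> 0" using sin_gt_zero[of "t / 2"] assms by simp
  then show ?thesis
    unfolding moebius_phi_def[abs_def]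
    by (auto intro!: derivative_eq_intros DERIV_chain2[OF DERIV_cot] simp: field_simps)
qed

text \<open>The weight becomes \<open>sin (t / 2) ^ (2 * d + 2)\<close>. The Jacobian cancels two of
  these factors and the denominator of \<open>moebius_phi t ^ m\<close> cancels \<open>m\<close>
  more; \<open>m \<le> 2 * d\<close> ensures that no pole remains.\<close>

lemma power_weight_moebius_phi:
  assumes "0 < t" "t < 2 * pi" "m \<le> 2 * d"
  shows "moebius_phi t ^ m * weight (2 * (d + 1)) (moebius_phi t) * (1 / (2 * (sin (t / 2))\<^sup>2))
    = (- 1) ^ m / 2 * (cos (t / 2) ^ m * sin (t / 2) ^ (2 * d - m))"
proof -
  define s where "s = sin (t / 2)"
  define c where "c = cos (t / 2)"
  have s: "s > 0" unfolding s_def using sin_gt_zero[of "t / 2"] assms by simp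
  have "s\<^sup>2 + c\<^sup>2 = 1" by (simp add: s_def c_def)
  then have x: "1 + (moebius_phi t)\<^sup>2 = 1 / s\<^sup>2"
    unfolding moebius_phi_def cot_def using s
    by (simp add: s_def [symmetric] c_def [symmetric] field_simps)
  have "weight (2 * (d + 1)) (moebius_phi t) = (1 / s\<^sup>2) powr (- real (d + 1))"
    unfolding weight_def x by (intro arg_cong2[where f = "(powr)"]) auto
  also have "\<dots> = (s\<^sup>2) ^ (d + 1)"
    using s by (simp add: powr_minus powr_realpow power_divide del: power_Suc of_nat_add of_nat_Suc)
  finally have w: "weight (2 * (d + 1)) (moebius_phi t) = (s\<^sup>2) ^ d * s\<^sup>2" by simp
  have "(s\<^sup>2) ^ d = s ^ (2 * d - m) * s ^ m"
    using assms(3) by (simp flip: power_mult power_add)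
  then have "(- (c / s)) ^ m * ((s\<^sup>2) ^ d * s\<^sup>2) * (1 / (2 * s\<^sup>2))
      = (- 1) ^ m / 2 * (c ^ m * s ^ (2 * d - m))"
    using s by (simp add: power_minus[of "c / s"] power_divide)
  then show ?thesis
    unfolding w by (simp add: moebius_phi_def cot_def s_def c_def)
qed

theorem proposition4p1:
  fixes n \<upsilon> m :: nat
  assumes "even \<upsilon>" and "0 < \<upsilon>" and "\<upsilon> \<le> 2 * n" and "m \<le> \<upsilon> - 2"
  shows "integrable lborel (\<lambda>x::real. x ^ m * weight \<upsilon> x)
    \<and> (\<integral>x. x ^ m * weight \<upsilon> x \<partial>lborel) = moebius_trapezoid (weight \<upsilon>) n (\<lambda>x. x ^ m)"
proof -
  \<comment> \<open>With \<open>d = \<upsilon> / 2 - 1\<close>, the bound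
    \<open>\<upsilon> \<le> 2 * n\<close> becomes \<open>d < n\<close>, the condition for
    exactness.\<close>
  obtain d where \<upsilon>: "\<upsilon> = 2 * (d + 1)"
    using assms(1,2) by (metis Suc_eq_plus1 dvdE gr0_conv_Suc mult_is_0 not_gr0)
  then have d: "d < n" "m \<le> 2 * d" using assms by auto
  let ?f = "\<lambda>x::real. x ^ m * weight \<upsilon> x"
  let ?D = "\<lambda>t::real. 1 / (2 * (sin (t / 2))\<^sup>2)"
  let ?h = "\<lambda>t::real. (- 1) ^ m / 2 * (cos (t / 2) ^ m * sin (t / 2) ^ (2 * d - m))"
  have f_phi: "?f (moebius_phi t) * ?D t = ?h t" if "0 < t" "t < 2 * pi" for t
    using power_weight_moebius_phi[OF that d(2)] by (simp only: \<upsilon>)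
  have trap: "moebius_trapezoid (weight \<upsilon>) n (\<lambda>x. x ^ m)
      = (- 1) ^ m / 2 * (2 * pi / n
          * (\<Sum>j = 1..n. cos (trap_node n j / 2) ^ m * sin (trap_node n j / 2) ^ (2 * d - m)))"
  proof -
    have "(\<Sum>j = 1..n. ?f (moebius_phi (trap_node n j)) * deriv moebius_phi (trap_node n j))
        = (\<Sum>j = 1..n. ?h (trap_node n j))"
      by (intro sum.cong refl)
        (simp only: deriv_moebius_phi[OF trap_node_bounds] f_phi[OF trap_node_bounds])
    then show ?thesis
      unfolding moebius_trapezoid_def by (simp add: sum_distrib_left mult_ac)
  qed
  have h_int: "(?h has_integral moebius_trapezoid (weight \<upsilon>) n (\<lambda>x. x ^ m)) {0<..<2 * pi}"
    unfolding trap has_integral_Icc_iff_Ioo [symmetric]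
    using d by (intro has_integral_mult_right trapezoid_exact_cos_pow_sin_pow) auto
  \<comment> \<open>Continuity on the closed period gives absolute integrability, which the
    substitution later carries over to \<open>?f\<close> on the whole line.\<close>
  have "?h absolutely_integrable_on {0..2 * pi}"
    by (intro absolutely_integrable_continuous_real continuous_intros) auto
  then have h_abs: "?h absolutely_integrable_on {0<..<2 * pi}"
    by (rule set_integrable_subset) auto
  have eq: "\<bar>?D t\<bar> * ?f (moebius_phi t) = ?h t" if "t \<in> {0<..<2 * pi}" for t
    using f_phi[of t] that by (simp add: mult_ac)
  have "(\<lambda>t. \<bar>?D t\<bar> * ?f (moebius_phi t)) absolutely_integrable_on {0<..<2 * pi}"
    by (rule iffD2[OF set_integrable_cong[OF refl refl eq] h_abs])
  moreover have "integral {0<..<2 * pi} (\<lambda>t. \<bar>?D t\<bar> * ?f (moebius_phi t))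
      = moebius_trapezoid (weight \<upsilon>) n (\<lambda>x. x ^ m)"
    using integral_cong[OF eq] integral_unique[OF h_int] by (rule trans)
  ultimately have "?f absolutely_integrable_on (moebius_phi ` {0<..<2 * pi})
      \<and> integral (moebius_phi ` {0<..<2 * pi}) ?f
          = moebius_trapezoid (weight \<upsilon>) n (\<lambda>x. x ^ m)"
    \<comment> \<open>The change of variables is an equivalence, read here from the interval to its
      image; it transfers integrability and value together.\<close>
    by (subst has_absolute_integral_change_of_variables_1' [symmetric, where g' = ?D])
      (auto intro!: inj_on_moebius_phi has_derivative_moebius_phi
        intro: has_field_derivative_at_within)
  then have f: "?f absolutely_integrable_on UNIV"
      "integral UNIV ?f = moebius_trapezoid (weight \<upsilon>) n (\<lambda>x. x ^ m)"
    by (simp_all only: moebius_phi_image)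
  \<comment> \<open>Borel measurability brings integrability down from the completed measure to
    \<open>lborel\<close>.\<close>
  have meas: "?f \<in> borel_measurable lborel" unfolding weight_def by measurable
  have int: "integrable lborel ?f"
    using f(1) integrable_completion[OF meas] by (simp add: set_integrable_def)
  show ?thesis
    using int f(2) integral_lborel[OF int] by simp
qed

end
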